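(* Let $A \in \mathbb{R}^{m\times n}$ ($m \ge n$) have full column rank with reduced QR decomposition $A = QR$, $Q^TQ = I_n$; let $\bm a_i$ and $\bm q_i$ denote the $i$-th rows of $A$ and $Q$ respectively (note $\sum_{i=1}^m\|\bm q_i\|_2^2 = n$). Let $l \ge n$ and form $A_1\in\mathbb{R}^{l\times n}$ as follows: independently for $s = 1,\dots,l$, choose an index $i_s \in\{1,\dots,m\}$ with $\mathbb{P}[i_s = k] = \|\bm q_k\|_2^2/n$, and let the $s$-th row of $A_1$ be $\|\bm q_{i_s}\|_2^{-1}\bm a_{i_s}$. When $A_1$ has full column rank let $R_1$ be the upper triangular factor (positive diagonal) of a reduced QR decomposition of $A_1$ and $X := AR_1^{-1}$; when $A_1$ is rank deficient set $\operatorname{cond}(X) := +\infty$. Then for every $\delta>0$ and $\varepsilon\in(0,1)$, $$\mathbb{P}\left[\operatorname{cond}(X) \ge \sqrt{\frac{1+\delta}{1-\varepsilon}}\right] \le n\left[\left(\frac{e^{-\varepsilon}}{(1-\varepsilon)^{1-\varepsilon}}\right)^{l/n} + \left(\frac{e^{\delta}}{(1+\delta)^{1+\delta}}\right)^{l/n}\right].$$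
   Context: For a full column rank matrix $M$, $\operatorname{cond}(M) = \sigma_{\max}(M)/\sigma_{\min}(M)$, the ratio of its largest and smallest (i.e. $n$-th) singular values. *)

theory Defs
  imports "HOL-Analysis.Analysis" "HOL-Probability.Probability"
begin

definition upper_tri :: "real^('n::{finite,wellorder})^('n::{finite,wellorder}) \<Rightarrow> bool" where
  "upper_tri R \<longleftrightarrow> (\<forall>i j. j < i \<longrightarrow> R $ i $ j = 0)"

definition singular_values :: "real^'n::finite^'m::finite \<Rightarrow> real set" where
  "singular_values M = {sqrt lam | lam. \<exists>v. v \<noteq> 0 \<and> (transpose M ** M) *v v = lam *\<^sub>R v}"

definition cond :: "real^'n::finite^'m::finite \<Rightarrow> real" where
  "cond M = Max (singular_values M) / Min (singular_values M)"

text \<open>The R factor of a reduced QR decomposition with positive diagonal (unique for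
  full column rank matrices).\<close>
definition qr_R :: "real^('n::{finite,wellorder})^('l::finite) \<Rightarrow> real^('n::{finite,wellorder})^('n::{finite,wellorder})" where
  "qr_R B = (SOME R. upper_tri R \<and> (\<forall>i. R $ i $ i > 0) \<and>
       (\<exists>Q::real^('n::{finite,wellorder})^('l::finite). transpose Q ** Q = mat 1 \<and> B = Q ** R))"

definition lev_pmf :: "real^'n::finite^'m::finite \<Rightarrow> 'm pmf" where
  "lev_pmf Q = embed_pmf (\<lambda>k. (norm (row k Q))\<^sup>2 / real CARD('n))"

definition sampled_matrix ::
  "real^'n::finite^'m::finite \<Rightarrow> real^'n^'m \<Rightarrow> ('l::finite \<Rightarrow> 'm) \<Rightarrow> real^'n^'l" where
  "sampled_matrix A Q \<omega> = (\<chi> s. (1 / norm (row (\<omega> s) Q)) *\<^sub>R row (\<omega> s) A)"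

end

theory Submission
  imports Defs
begin

text \<open>With \<open>u\<^sub>k = q\<^sub>k / \<parallel>q\<^sub>k\<parallel>\<close> and \<open>U\<close> the matrix of sampled rows \<open>u\<close>, the sketch is \<open>A\<^sub>1 = U R\<close>, and
  \<open>cond X\<close> is the square root of the ratio of the extreme eigenvalues of \<open>U\<^sup>T U\<close>, a sum of
  \<open>l\<close> independent rank one matrices with mean \<open>I / n\<close>. Both tails come from the Laplace transform
  \<open>E tr exp (\<theta> U\<^sup>T U)\<close>. As the mean is a multiple of the identity, Lieb's theorem is not needed: it
  suffices that \<open>tr exp (H + \<theta> u u\<^sup>T) \<le> tr exp H + (e\<^sup>\<theta> - 1) u\<^sup>T (exp H) u\<close> for \<open>\<parallel>u\<parallel> \<le> 1\<close>.
  This follows from Klein's inequality along small steps in \<open>\<theta>\<close>, once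
  \<open>u\<^sup>T exp (H + t u u\<^sup>T) u \<le> e\<^sup>t u\<^sup>T (exp H) u\<close> is known for \<open>t \<ge> 0\<close>; the latter is proved for
  powers in place of the exponential, where a recursion on the exponent only requires Chebyshev's sum
  inequality.\<close>

section \<open>Spectral theorem for self-adjoint operators\<close>

definition selfadjoint :: "('a::euclidean_space \<Rightarrow> 'a) \<Rightarrow> bool" where
  "selfadjoint f \<longleftrightarrow> linear f \<and> (\<forall>x y. f x \<bullet> y = x \<bullet> f y)"

text \<open>Eigenvalues are not listed separately: that of the unit vector \<open>b\<close> is its
  Rayleigh quotient \<open>b \<bullet> f b\<close>, so a set of vectors carries the whole spectrum
  with multiplicities.\<close>

definition eigenbasis :: "('a::euclidean_space \<Rightarrow> 'a) \<Rightarrow> 'a set \<Rightarrow> bool" where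
  "eigenbasis f B \<longleftrightarrow> finite B \<and> pairwise orthogonal B \<and> span B = UNIV \<and>
     (\<forall>b\<in>B. norm b = 1 \<and> f b = (b \<bullet> f b) *\<^sub>R b)"

text \<open>A function with minimum value 0 at t = 0 has zero derivative there. This is the
  first-order condition for a maximiser of the Rayleigh quotient.\<close>

lemma linear_coeff_zero:
  fixes a c :: real
  assumes "\<And>t. 2 * t * a + t\<^sup>2 * c \<ge> 0"
  shows "a = 0"
proof (rule ccontr)
  assume "a \<noteq> 0"
  \<comment> \<open>With d > 0 and d > c, the choice t = -a/d makes the negative linear part
    outweigh the quadratic part.\<close>
  define d where "d = \<bar>c\<bar> + 1"
  have d: "d > 0" "c < d" by (auto simp: d_def)
  have "0 \<le> 2 * (-a/d) * a + (-a/d)\<^sup>2 * c" by (rule assms)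
  also have "\<dots> = (a\<^sup>2/d) * (c/d - 2)"
    using d by (simp add: field_simps power2_eq_square)
  also have "\<dots> < 0"
  proof (rule mult_pos_neg)
    have "c / d < 1" using d by simp
    then show "c / d - 2 < 0" by simp
  qed (use d \<open>a \<noteq> 0\<close> in simp)
  finally show False by simp
qed

text \<open>The maximiser of the Rayleigh quotient is an eigenvector.\<close>
lemma selfadjoint_eigenvector_subspace:
  fixes f :: "'a::euclidean_space \<Rightarrow> 'a"
  assumes f: "selfadjoint f" and V: "subspace V" "V \<noteq> {0}" and inv: "f ` V \<subseteq> V"
  obtains v where "v \<in> V" "norm v = 1" "f v = (v \<bullet> f v) *\<^sub>R v"
proof -
  have lin: "linear f" and sym: "\<And>x y. f x \<bullet> y = x \<bullet> f y"
    using f by (auto simp: selfadjoint_def)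
  have "0 \<in> V" using V subspace_0 by blast
  then obtain x where "x \<in> V" "x \<noteq> 0" using V(2) by blast
  then have ne: "x /\<^sub>R norm x \<in> V \<inter> sphere 0 1"
    using V(1) by (simp add: subspace_scale)
  have "compact (V \<inter> sphere 0 1)"
    by (simp add: V(1) closed_Int_compact closed_subspace)
  moreover have "continuous_on (V \<inter> sphere 0 1) (\<lambda>x. x \<bullet> f x)"
    using lin by (intro continuous_intros linear_continuous_on linear_conv_bounded_linear[THEN iffD1])
  ultimately obtain v where v: "v \<in> V \<inter> sphere 0 1"
    and max: "\<And>y. y \<in> V \<inter> sphere 0 1 \<Longrightarrow> y \<bullet> f y \<le> v \<bullet> f v"
    using continuous_attains_sup[of "V \<inter> sphere 0 1" "\<lambda>x. x \<bullet> f x"] ne by blast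
  define lam where "lam = v \<bullet> f v"
  have vv: "v \<bullet> v = 1" using v by (simp add: dot_square_norm)
  have le: "y \<bullet> f y \<le> lam * (y \<bullet> y)" if "y \<in> V" for y
  proof (cases "y = 0")
    case False
    have "y /\<^sub>R norm y \<in> V \<inter> sphere 0 1" using that False V(1) by (simp add: subspace_scale)
    from max[OF this] have "(y \<bullet> f y) / (norm y)\<^sup>2 \<le> lam"
      by (simp add: lam_def linear_scale[OF lin] power2_eq_square divide_inverse mult_ac)
    then show ?thesis using False by (simp add: divide_le_eq power2_norm_eq_inner)
  qed (simp add: linear_0[OF lin])
  \<comment> \<open>The direction of variation is the residual \<open>w\<close>. The linear
    coefficient along it is \<open>-(w \<bullet> w)\<close>, so stationarity forces
    \<open>w = 0\<close>.\<close>
  define w where "w = f v - lam *\<^sub>R v"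
  have wV: "w \<in> V" using v inv V(1) by (auto simp: w_def intro!: subspace_diff subspace_scale)
  have "lam * (v \<bullet> w) - f v \<bullet> w = 0"
  proof (rule linear_coeff_zero[where c = "lam * (w \<bullet> w) - w \<bullet> f w"])
    fix t :: real
    have "v + t *\<^sub>R w \<in> V" using v wV V(1) by (simp add: subspace_add subspace_scale)
    from le[OF this] have "v \<bullet> f v + 2 * t * (f v \<bullet> w) + t\<^sup>2 * (w \<bullet> f w)
        \<le> lam * (v \<bullet> v + 2 * t * (v \<bullet> w) + t\<^sup>2 * (w \<bullet> w))"
      using sym[of v w] inner_commute[of w "f v"] inner_commute[of w v]
      by (simp add: linear_add[OF lin] linear_scale[OF lin] inner_add_left inner_add_right
          algebra_simps power2_eq_square)
    then show "2 * t * (lam * (v \<bullet> w) - f v \<bullet> w) + t\<^sup>2 * (lam * (w \<bullet> w) - w \<bullet> f w) \<ge> 0"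
      using vv by (simp add: lam_def[symmetric] algebra_simps)
  qed
  then have "w \<bullet> w = 0" by (simp add: w_def inner_simps algebra_simps)
  then have "f v = lam *\<^sub>R v" by (simp add: w_def)
  with v show thesis by (intro that) (auto simp: lam_def)
qed

text \<open>Induction on the dimension: split off one eigenvector \<open>v\<close>; its orthogonal
  complement in \<open>V\<close> is again invariant because \<open>f\<close> is self-adjoint. The
  statement ranges over invariant subspaces so that the induction applies to that
  complement.\<close>

lemma selfadjoint_eigenbasis_subspace:
  fixes f :: "'a::euclidean_space \<Rightarrow> 'a"
  assumes f: "selfadjoint f" and "subspace V" and "f ` V \<subseteq> V"
  shows "\<exists>B. finite B \<and> pairwise orthogonal B \<and> span B = V \<and>
     (\<forall>b\<in>B. norm b = 1 \<and> f b = (b \<bullet> f b) *\<^sub>R b)"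
  using assms(2,3)
proof (induction "dim V" arbitrary: V rule: less_induct)
  case less
  have lin: "linear f" and sym: "\<And>x y. f x \<bullet> y = x \<bullet> f y"
    using f by (auto simp: selfadjoint_def)
  show ?case
  proof (cases "V = {0}")
    case True
    then show ?thesis by (intro exI[of _ "{}"]) auto
  next
    case False
    obtain v where v: "v \<in> V" "norm v = 1" "f v = (v \<bullet> f v) *\<^sub>R v"
      using selfadjoint_eigenvector_subspace[OF f less.prems(1) False less.prems(2)] .
    have vv: "v \<bullet> v = 1" using v by (simp add: dot_square_norm)
    define W where "W = {x \<in> V. v \<bullet> x = 0}"
    have W: "subspace W"
      using less.prems(1) by (auto simp: W_def subspace_def inner_simps)
    have "v \<notin> W" using vv by (simp add: W_def)
    moreover have "W \<subseteq> V" by (auto simp: W_def)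
    ultimately have WV: "W \<subset> V" using v(1) by blast
    then have "dim W < dim V"
      using W less.prems(1) by (intro dim_psubset) (metis span_eq_iff)
    moreover have "f ` W \<subseteq> W"
    proof -
      have "v \<bullet> f x = 0" if "v \<bullet> x = 0" for x
        using that v(3) by (metis sym inner_scaleR_left mult_zero_right)
      then show ?thesis using less.prems(2) by (auto simp: W_def)
    qed
    ultimately obtain B where B: "finite B" "pairwise orthogonal B" "span B = W"
      "\<And>b. b\<in>B \<Longrightarrow> norm b = 1 \<and> f b = (b \<bullet> f b) *\<^sub>R b"
      using less.hyps[OF _ W] by blast
    have BW: "B \<subseteq> W" using B(3) span_superset by blast
    have "span (insert v B) = V"
    proof
      show "span (insert v B) \<subseteq> V"
        using BW WV v(1) less.prems(1) by (intro span_minimal) auto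
      show "V \<subseteq> span (insert v B)"
      proof
        fix x assume "x \<in> V"
        then have "x - (v \<bullet> x) *\<^sub>R v \<in> span B"
          using v(1) vv less.prems(1) by (auto simp: B(3) W_def inner_simps subspace_diff subspace_scale)
        then show "x \<in> span (insert v B)" using span_insert by blast
      qed
    qed
    moreover have "pairwise orthogonal (insert v B)"
      using B(2) BW by (auto simp: pairwise_insert W_def orthogonal_def inner_commute)
    ultimately show ?thesis using B v by (intro exI[of _ "insert v B"]) auto
  qed
qed

theorem selfadjoint_eigenbasis: "selfadjoint f \<Longrightarrow> \<exists>B. eigenbasis f B"
  using selfadjoint_eigenbasis_subspace[of f UNIV] by (auto simp: eigenbasis_def)

lemma eigenbasis_parseval:
  assumes "eigenbasis f B"
  shows "(\<Sum>b\<in>B. (b \<bullet> x) * (b \<bullet> y)) = x \<bullet> y"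
proof -
  have "(\<Sum>b\<in>B. (x \<bullet> b) *\<^sub>R b) = x"
    using assms by (intro orthonormal_basis_expand) (auto simp: eigenbasis_def)
  then have "x \<bullet> y = (\<Sum>b\<in>B. (x \<bullet> b) *\<^sub>R b) \<bullet> y" by simp
  then show ?thesis by (simp add: inner_sum_left inner_commute[of x])
qed

lemma eigenbasis_norm:
  assumes "eigenbasis f B"
  shows "(\<Sum>b\<in>B. (b \<bullet> x)\<^sup>2) = (norm x)\<^sup>2"
  using eigenbasis_parseval[OF assms, of x x] by (simp add: power2_eq_square power2_norm_eq_inner[symmetric])

lemma eigenbasis_inner:
  assumes "eigenbasis f B" "selfadjoint f" "b \<in> B"
  shows "b \<bullet> f x = (b \<bullet> f b) * (b \<bullet> x)"
  using assms unfolding eigenbasis_def selfadjoint_def by (metis inner_scaleR_left)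

lemma eigenbasis_quadratic_form:
  assumes "eigenbasis f B" "selfadjoint f"
  shows "x \<bullet> f x = (\<Sum>b\<in>B. (b \<bullet> f b) * (b \<bullet> x)\<^sup>2)"
  unfolding eigenbasis_parseval[OF assms(1), of x "f x", symmetric]
  by (intro sum.cong) (auto simp: eigenbasis_inner[OF assms, of _ x] power2_eq_square)

lemma eigenbasis_card:
  fixes f :: "'a::euclidean_space \<Rightarrow> 'a"
  assumes "eigenbasis f B"
  shows "card B = DIM('a)"
proof -
  have "independent B"
    using assms by (intro pairwise_orthogonal_independent) (auto simp: eigenbasis_def)
  then show ?thesis
    using assms by (metis eigenbasis_def basis_card_eq_dim dim_UNIV subset_UNIV)
qed

section \<open>Rank one perturbations and the trace exponential\<close>

text \<open>Klein's inequality: average the scalar tangent line bound against the doubly stochastic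
  matrix \<open>(b \<bullet> c)\<^sup>2\<close>.\<close>
lemma klein_exp:
  assumes f: "eigenbasis f B" "selfadjoint f" and g: "eigenbasis g C"
  shows "(\<Sum>c\<in>C. exp (c \<bullet> g c) * (1 + c \<bullet> f c - c \<bullet> g c)) \<le> (\<Sum>b\<in>B. exp (b \<bullet> f b))"
proof -
  have B: "(\<Sum>b\<in>B. (b \<bullet> c)\<^sup>2) = 1" if "c \<in> C" for c
    using that g by (simp add: eigenbasis_norm[OF f(1)] eigenbasis_def)
  have C: "(\<Sum>c\<in>C. (b \<bullet> c)\<^sup>2) = 1" if "b \<in> B" for b
    using that f eigenbasis_norm[OF g, of b] by (simp add: eigenbasis_def inner_commute)
  have "(\<Sum>c\<in>C. exp (c \<bullet> g c) * (1 + c \<bullet> f c - c \<bullet> g c))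
     = (\<Sum>c\<in>C. \<Sum>b\<in>B. (b \<bullet> c)\<^sup>2 * (exp (c \<bullet> g c) * (1 + b \<bullet> f b - c \<bullet> g c)))"
  proof (rule sum.cong)
    fix c assume c: "c \<in> C"
    have "(\<Sum>b\<in>B. (b \<bullet> c)\<^sup>2 * (exp (c \<bullet> g c) * (1 + b \<bullet> f b - c \<bullet> g c)))
      = exp (c \<bullet> g c) * ((\<Sum>b\<in>B. (b \<bullet> c)\<^sup>2) * (1 - c \<bullet> g c) + (\<Sum>b\<in>B. (b \<bullet> f b) * (b \<bullet> c)\<^sup>2))"
      by (simp add: sum_distrib_left sum_distrib_right sum.distrib[symmetric] algebra_simps)
    then show "exp (c \<bullet> g c) * (1 + c \<bullet> f c - c \<bullet> g c)
       = (\<Sum>b\<in>B. (b \<bullet> c)\<^sup>2 * (exp (c \<bullet> g c) * (1 + b \<bullet> f b - c \<bullet> g c)))"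
      by (simp add: B[OF c] eigenbasis_quadratic_form[OF f, of c])
  qed simp
  also have "\<dots> \<le> (\<Sum>c\<in>C. \<Sum>b\<in>B. (b \<bullet> c)\<^sup>2 * exp (b \<bullet> f b))"
  proof (intro sum_mono mult_left_mono)
    fix c b
    have "exp (c \<bullet> g c) * (1 + (b \<bullet> f b - c \<bullet> g c)) \<le> exp (c \<bullet> g c) * exp (b \<bullet> f b - c \<bullet> g c)"
      by (intro mult_left_mono exp_ge_add_one_self) auto
    then show "exp (c \<bullet> g c) * (1 + b \<bullet> f b - c \<bullet> g c) \<le> exp (b \<bullet> f b)"
      by (simp add: exp_add[symmetric] algebra_simps)
  qed auto
  also have "\<dots> = (\<Sum>b\<in>B. exp (b \<bullet> f b))"
    by (subst sum.swap) (simp add: sum_distrib_right[symmetric] C)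
  finally show ?thesis .
qed

text \<open>Summing w_i w_k (p_i - p_k)(q_i - q_k) over all pairs gives twice the difference of the
  two sides, apart from a factor \<open>sum w I\<close> on the right. Total weight below one is
  allowed because the weights will be \<open>(b \<bullet> u)\<^sup>2\<close> with
  \<open>norm u \<le> 1\<close>; the sign of \<open>p i * q i\<close> absorbs the deficit.\<close>

lemma chebyshev_weighted:
  fixes w p q :: "'b \<Rightarrow> real"
  assumes "finite I" and w: "\<And>i. i \<in> I \<Longrightarrow> w i \<ge> 0" and 1: "sum w I \<le> 1"
    and mono: "\<And>i k. i \<in> I \<Longrightarrow> k \<in> I \<Longrightarrow> (p i - p k) * (q i - q k) \<ge> 0"
    and pq: "\<And>i. i \<in> I \<Longrightarrow> p i * q i \<ge> 0"
  shows "(\<Sum>i\<in>I. w i * p i) * (\<Sum>i\<in>I. w i * q i) \<le> (\<Sum>i\<in>I. w i * (p i * q i))"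
proof -
  let ?S = "\<Sum>i\<in>I. w i * (p i * q i)"
  let ?X = "(\<Sum>i\<in>I. w i * p i) * (\<Sum>i\<in>I. w i * q i)"
  have "0 \<le> (\<Sum>i\<in>I. \<Sum>k\<in>I. w i * w k * ((p i - p k) * (q i - q k)))"
    by (intro sum_nonneg mult_nonneg_nonneg[of "w _ * w _"] mult_nonneg_nonneg[of "w _" "w _"] mono w)
  also have "\<dots> = (\<Sum>i\<in>I. \<Sum>k\<in>I. (w i * (p i * q i)) * w k) + (\<Sum>i\<in>I. \<Sum>k\<in>I. w i * (w k * (p k * q k)))
      - (\<Sum>i\<in>I. \<Sum>k\<in>I. (w i * p i) * (w k * q k)) - (\<Sum>i\<in>I. \<Sum>k\<in>I. (w i * q i) * (w k * p k))"
    unfolding sum.distrib[symmetric] sum_subtractf[symmetric] by (intro sum.cong) (auto simp: algebra_simps)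
  also have "\<dots> = ?S * sum w I + sum w I * ?S - ?X - (\<Sum>i\<in>I. w i * q i) * (\<Sum>i\<in>I. w i * p i)"
    unfolding sum_product ..
  finally have "?X \<le> sum w I * ?S" by (simp add: mult.commute)
  also have "\<dots> \<le> 1 * ?S"
    by (intro mult_right_mono sum_nonneg 1 mult_nonneg_nonneg[of "w _"] w pq)
  finally show ?thesis by simp
qed

section \<open>Powers and exponentials of rank one updates\<close>

definition rank1_upd :: "('a::euclidean_space \<Rightarrow> 'a) \<Rightarrow> real \<Rightarrow> 'a \<Rightarrow> 'a \<Rightarrow> 'a" where
  "rank1_upd f t u = (\<lambda>x. f x + t *\<^sub>R (u \<bullet> x) *\<^sub>R u)"

lemma selfadjoint_rank1_upd: "selfadjoint f \<Longrightarrow> selfadjoint (rank1_upd f t u)"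
  unfolding selfadjoint_def rank1_upd_def
  by (auto intro!: linearI simp: linear_add linear_scale inner_simps algebra_simps inner_commute)

text \<open>In operator form: u^T f^k (f + t u u^T)^N u \<le> u^T f^k (f + t)^N u. The factor f^k
  lets the induction on \<open>N\<close> close: peeling off the outermost perturbed factor, the
  summand f raises \<open>k\<close> by one, and the rank one summand leaves a product of two forms
  in u, which Chebyshev's inequality merges.\<close>

lemma rank1_upd_power_le:
  fixes u :: "'a::euclidean_space"
  assumes f: "eigenbasis f B" "selfadjoint f" and pos: "\<And>b. b \<in> B \<Longrightarrow> b \<bullet> f b \<ge> 0"
    and t: "t \<ge> 0" and u: "norm u \<le> 1"
  shows "(\<Sum>b\<in>B. (b \<bullet> u) * (b \<bullet> f b) ^ k * (b \<bullet> (rank1_upd f t u ^^ N) u))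
     \<le> (\<Sum>b\<in>B. (b \<bullet> u)\<^sup>2 * ((b \<bullet> f b) ^ k * (b \<bullet> f b + t) ^ N))"
proof (induction N arbitrary: k)
  case 0
  then show ?case by (simp add: power2_eq_square mult_ac)
next
  case (Suc N)
  define x where "x = (rank1_upd f t u ^^ N) u"
  have fin: "finite B" using f by (simp add: eigenbasis_def)
  have ux: "u \<bullet> x \<le> (\<Sum>b\<in>B. (b \<bullet> u)\<^sup>2 * (b \<bullet> f b + t) ^ N)"
    using Suc[of 0] eigenbasis_parseval[OF f(1), of u x] by (simp add: x_def)
  have bx: "b \<bullet> rank1_upd f t u x = (b \<bullet> f b) * (b \<bullet> x) + t * (u \<bullet> x) * (b \<bullet> u)" if "b \<in> B" for b
    by (simp add: rank1_upd_def inner_simps eigenbasis_inner[OF f that, of x] mult_ac)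
  \<comment> \<open>On nonnegative eigenvalues, both the power \<open>k\<close> and the shifted
    power \<open>N\<close> are nondecreasing, hence similarly ordered.\<close>
  have cheb: "(\<Sum>b\<in>B. (b \<bullet> u)\<^sup>2 * (b \<bullet> f b) ^ k) * (\<Sum>b\<in>B. (b \<bullet> u)\<^sup>2 * (b \<bullet> f b + t) ^ N)
     \<le> (\<Sum>b\<in>B. (b \<bullet> u)\<^sup>2 * ((b \<bullet> f b) ^ k * (b \<bullet> f b + t) ^ N))"
  proof (rule chebyshev_weighted[OF fin])
    show "(\<Sum>b\<in>B. (b \<bullet> u)\<^sup>2) \<le> 1"
      using u by (simp add: eigenbasis_norm[OF f(1)] power_le_one)
    fix i j assume ij: "i \<in> B" "j \<in> B"
    have mono: "(p ^ k - q ^ k) * ((p + t) ^ N - (q + t) ^ N) \<ge> 0"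
      if "0 \<le> q" "q \<le> p" for p q :: real
      using that t by (intro mult_nonneg_nonneg) (auto intro!: power_mono)
    show "((i \<bullet> f i) ^ k - (j \<bullet> f j) ^ k) * ((i \<bullet> f i + t) ^ N - (j \<bullet> f j + t) ^ N) \<ge> 0"
    proof (cases "j \<bullet> f j \<le> i \<bullet> f i")
      case True
      then show ?thesis using mono pos ij by blast
    next
      case False
      then have "((j \<bullet> f j) ^ k - (i \<bullet> f i) ^ k) * ((j \<bullet> f j + t) ^ N - (i \<bullet> f i + t) ^ N) \<ge> 0"
        using pos ij by (intro mono) auto
      then show ?thesis by (simp add: algebra_simps)
    qed
  qed (use pos t in auto)
  have "(\<Sum>b\<in>B. (b \<bullet> u) * (b \<bullet> f b) ^ k * (b \<bullet> (rank1_upd f t u ^^ Suc N) u))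
     = (\<Sum>b\<in>B. (b \<bullet> u) * (b \<bullet> f b) ^ Suc k * (b \<bullet> x))
       + t * ((\<Sum>b\<in>B. (b \<bullet> u)\<^sup>2 * (b \<bullet> f b) ^ k) * (u \<bullet> x))"
    by (simp add: x_def[symmetric] bx sum_distrib_left sum_distrib_right sum.distrib[symmetric]
        power2_eq_square algebra_simps cong: sum.cong)
  also have "\<dots> \<le> (\<Sum>b\<in>B. (b \<bullet> u)\<^sup>2 * ((b \<bullet> f b) ^ Suc k * (b \<bullet> f b + t) ^ N))
       + t * ((\<Sum>b\<in>B. (b \<bullet> u)\<^sup>2 * (b \<bullet> f b) ^ k) * (\<Sum>b\<in>B. (b \<bullet> u)\<^sup>2 * (b \<bullet> f b + t) ^ N))"
    using t pos by (intro add_mono mult_left_mono ux Suc[of "Suc k", folded x_def] sum_nonneg mult_nonneg_nonneg) auto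
  also have "\<dots> \<le> (\<Sum>b\<in>B. (b \<bullet> u)\<^sup>2 * ((b \<bullet> f b) ^ Suc k * (b \<bullet> f b + t) ^ N))
       + t * (\<Sum>b\<in>B. (b \<bullet> u)\<^sup>2 * ((b \<bullet> f b) ^ k * (b \<bullet> f b + t) ^ N))"
    by (intro add_left_mono mult_left_mono cheb t)
  also have "\<dots> = (\<Sum>b\<in>B. (b \<bullet> u)\<^sup>2 * ((b \<bullet> f b) ^ k * (b \<bullet> f b + t) ^ Suc N))"
    by (simp add: sum_distrib_left sum.distrib[symmetric] algebra_simps)
  finally show ?case .
qed

lemma eigenbasis_funpow:
  assumes "eigenbasis f B" "selfadjoint f" "b \<in> B"
  shows "b \<bullet> (f ^^ N) x = (b \<bullet> f b) ^ N * (b \<bullet> x)"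
  by (induction N) (auto simp: eigenbasis_inner[OF assms, of "(f ^^ _) x"])

text \<open>The left side is u^T g^N u for the perturbed operator g, computed in its own eigenbasis
  \<open>C\<close>. Parseval moves it to the eigenbasis \<open>B\<close> of \<open>f\<close>, where
  the previous recursion applies with exponent k = 0.\<close>

lemma rank1_upd_power_form_le:
  assumes f: "eigenbasis f B" "selfadjoint f" and pos: "\<And>b. b \<in> B \<Longrightarrow> b \<bullet> f b \<ge> 0"
    and t: "t \<ge> 0" and u: "norm u \<le> 1" and C: "eigenbasis (rank1_upd f t u) C"
  shows "(\<Sum>c\<in>C. (c \<bullet> u)\<^sup>2 * (c \<bullet> rank1_upd f t u c) ^ N) \<le> (\<Sum>b\<in>B. (b \<bullet> u)\<^sup>2 * (b \<bullet> f b + t) ^ N)"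
proof -
  let ?g = "rank1_upd f t u"
  have "(\<Sum>c\<in>C. (c \<bullet> u)\<^sup>2 * (c \<bullet> ?g c) ^ N) = (\<Sum>c\<in>C. (c \<bullet> u) * (c \<bullet> (?g ^^ N) u))"
    by (intro sum.cong) (auto simp: eigenbasis_funpow[OF C selfadjoint_rank1_upd[OF f(2)]] power2_eq_square)
  also have "\<dots> = u \<bullet> (?g ^^ N) u" by (rule eigenbasis_parseval[OF C])
  also have "\<dots> = (\<Sum>b\<in>B. (b \<bullet> u) * (b \<bullet> (?g ^^ N) u))" by (rule eigenbasis_parseval[OF f(1), symmetric])
  also have "\<dots> \<le> (\<Sum>b\<in>B. (b \<bullet> u)\<^sup>2 * (b \<bullet> f b + t) ^ N)"
    using rank1_upd_power_le[OF f pos t u, of 0 N] by simp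
  finally show ?thesis .
qed

lemma eigenbasis_affine:
  assumes "eigenbasis f B"
  shows "eigenbasis (\<lambda>x. x + r *\<^sub>R f x) B"
  using assms by (auto simp: eigenbasis_def inner_simps dot_square_norm)
    (metis scaleR_left.add scaleR_one scaleR_scaleR)

lemma selfadjoint_affine: "selfadjoint f \<Longrightarrow> selfadjoint (\<lambda>x. x + r *\<^sub>R f x)"
  unfolding selfadjoint_def
  by (auto intro!: linearI simp: linear_add linear_scale inner_simps algebra_simps)

text \<open>The scaling \<open>1 + f / N\<close> makes \<open>f\<close> positive for large \<open>N\<close>, and the \<open>N\<close>-th powers tend to
  the exponential.\<close>
lemma rank1_upd_exp_form_le:
  assumes f: "eigenbasis f B" "selfadjoint f"
    and t: "t \<ge> 0" and u: "norm u \<le> 1" and C: "eigenbasis (rank1_upd f t u) C"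
  shows "(\<Sum>c\<in>C. (c \<bullet> u)\<^sup>2 * exp (c \<bullet> rank1_upd f t u c)) \<le> exp t * (\<Sum>b\<in>B. (b \<bullet> u)\<^sup>2 * exp (b \<bullet> f b))"
proof -
  have norms: "c \<bullet> c = 1" if "c \<in> B \<or> c \<in> C" for c
    using that f C by (auto simp: eigenbasis_def dot_square_norm)
  have "(\<lambda>N. \<Sum>c\<in>C. (c \<bullet> u)\<^sup>2 * (1 + (c \<bullet> rank1_upd f t u c) / real N) ^ N)
      \<longlonglongrightarrow> (\<Sum>c\<in>C. (c \<bullet> u)\<^sup>2 * exp (c \<bullet> rank1_upd f t u c))"
    by (intro tendsto_intros tendsto_exp_limit_sequentially)
  moreover have "(\<lambda>N. \<Sum>b\<in>B. (b \<bullet> u)\<^sup>2 * (1 + (b \<bullet> f b + t) / real N) ^ N)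
      \<longlonglongrightarrow> (\<Sum>b\<in>B. (b \<bullet> u)\<^sup>2 * exp (b \<bullet> f b + t))"
    by (intro tendsto_intros tendsto_exp_limit_sequentially)
  moreover have "\<forall>\<^sub>F N in sequentially. (\<Sum>c\<in>C. (c \<bullet> u)\<^sup>2 * (1 + (c \<bullet> rank1_upd f t u c) / real N) ^ N)
      \<le> (\<Sum>b\<in>B. (b \<bullet> u)\<^sup>2 * (1 + (b \<bullet> f b + t) / real N) ^ N)"
  proof -
    have "\<forall>\<^sub>F N in sequentially. \<forall>b\<in>B. real N \<ge> - (b \<bullet> f b)"
      using f(1) filterlim_real_sequentially
      by (auto simp: eventually_ball_finite_distrib eigenbasis_def filterlim_at_top)
    then show ?thesis
      using eventually_gt_at_top[of 0]
    proof eventually_elim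
      case (elim N)
      let ?h = "\<lambda>x. x + (1 / real N) *\<^sub>R f x"
      \<comment> \<open>Updating 1 + f/N by t/N gives 1 + (f + t u u^T)/N, so \<open>C\<close>
        remains an eigenbasis for every N.\<close>
      have eq: "rank1_upd ?h (t / real N) u = (\<lambda>x. x + (1 / real N) *\<^sub>R rank1_upd f t u x)"
        by (auto simp: rank1_upd_def algebra_simps)
      have "(\<Sum>c\<in>C. (c \<bullet> u)\<^sup>2 * (c \<bullet> rank1_upd ?h (t / real N) u c) ^ N)
         \<le> (\<Sum>b\<in>B. (b \<bullet> u)\<^sup>2 * (b \<bullet> ?h b + t / real N) ^ N)"
      proof (rule rank1_upd_power_form_le[OF eigenbasis_affine[OF f(1)] selfadjoint_affine[OF f(2)] _ _ u])
        show "eigenbasis (rank1_upd ?h (t / real N) u) C"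
          unfolding eq by (rule eigenbasis_affine[OF C])
        fix b assume b: "b \<in> B"
        then have "real N + b \<bullet> f b \<ge> 0" using elim by force
        then show "b \<bullet> ?h b \<ge> 0" using elim b by (simp add: inner_simps norms field_simps)
      qed (use t in auto)
      then show ?case
        unfolding eq by (simp add: inner_simps norms add_divide_distrib algebra_simps cong: sum.cong)
    qed
  qed
  ultimately have "(\<Sum>c\<in>C. (c \<bullet> u)\<^sup>2 * exp (c \<bullet> rank1_upd f t u c)) \<le> (\<Sum>b\<in>B. (b \<bullet> u)\<^sup>2 * exp (b \<bullet> f b + t))"
    by (intro tendsto_le[OF sequentially_bot])
  then show ?thesis by (simp add: exp_add sum_distrib_left mult_ac)
qed

section \<open>The trace exponential under rank one updates\<close>

definition some_eigenbasis :: "('a::euclidean_space \<Rightarrow> 'a) \<Rightarrow> 'a set" where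
  "some_eigenbasis f = (SOME B. eigenbasis f B)"

definition trace_exp :: "('a::euclidean_space \<Rightarrow> 'a) \<Rightarrow> real" where
  "trace_exp f = (\<Sum>b\<in>some_eigenbasis f. exp (b \<bullet> f b))"

text \<open>For self-adjoint \<open>f\<close> this is u^T (exp f) u in spectral form; like the
  trace, it is written without forming an operator exponential.\<close>

definition exp_form :: "('a::euclidean_space \<Rightarrow> 'a) \<Rightarrow> 'a \<Rightarrow> real" where
  "exp_form f u = (\<Sum>b\<in>some_eigenbasis f. (b \<bullet> u)\<^sup>2 * exp (b \<bullet> f b))"

lemma some_eigenbasis: "selfadjoint f \<Longrightarrow> eigenbasis f (some_eigenbasis f)"
  unfolding some_eigenbasis_def by (rule someI_ex[OF selfadjoint_eigenbasis])

lemma rank1_upd_rank1_upd: "rank1_upd (rank1_upd f s u) t u = rank1_upd f (s + t) u"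
  by (auto simp: rank1_upd_def algebra_simps)

lemma rank1_upd_0 [simp]: "rank1_upd f 0 u = f"
  by (simp add: rank1_upd_def)

lemma exp_form_nonneg: "exp_form f u \<ge> 0"
  by (auto simp: exp_form_def intro!: sum_nonneg)

lemma exp_form_rank1_upd_le:
  "selfadjoint f \<Longrightarrow> t \<ge> 0 \<Longrightarrow> norm u \<le> 1 \<Longrightarrow> exp_form (rank1_upd f t u) u \<le> exp t * exp_form f u"
  unfolding exp_form_def
  by (rule rank1_upd_exp_form_le) (auto intro: some_eigenbasis selfadjoint_rank1_upd)

text \<open>Convexity of tr exp: Klein's inequality with base point \<open>f\<close> gives the
  tangent line, whose slope in the direction u u^T is \<open>exp_form f u\<close>. The sign of
  \<open>t\<close> is arbitrary.\<close>

lemma trace_exp_rank1_upd_ge: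
  assumes "selfadjoint f"
  shows "trace_exp f + t * exp_form f u \<le> trace_exp (rank1_upd f t u)"
proof -
  have "(\<Sum>c\<in>some_eigenbasis f. exp (c \<bullet> f c) * (1 + c \<bullet> rank1_upd f t u c - c \<bullet> f c)) \<le> trace_exp (rank1_upd f t u)"
    unfolding trace_exp_def using assms
    by (intro klein_exp) (auto intro: some_eigenbasis selfadjoint_rank1_upd)
  then show ?thesis
    by (simp add: trace_exp_def exp_form_def rank1_upd_def inner_simps sum_distrib_left
        sum.distrib[symmetric] algebra_simps power2_eq_square inner_commute)
qed

text \<open>The tangent at the far end \<open>s + d\<close> bounds the increment from above, and the
  growth bound then compares the form there with the form at \<open>f\<close>. The sign conditions
  describe a step leading away from 0, in either direction.\<close>

lemma trace_exp_rank1_upd_step: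
  assumes f: "selfadjoint f" and u: "norm u \<le> 1" and d: "s * d \<ge> 0" "(s + d) * d \<ge> 0"
  shows "trace_exp (rank1_upd f (s + d) u) - trace_exp (rank1_upd f s u) \<le> d * exp (s + d) * exp_form f u"
proof -
  let ?g = "rank1_upd f (s + d) u"
  have g: "selfadjoint ?g" by (rule selfadjoint_rank1_upd[OF f])
  have "trace_exp ?g - trace_exp (rank1_upd f s u) \<le> d * exp_form ?g u"
    using trace_exp_rank1_upd_ge[OF g, of "-d" u] by (simp add: rank1_upd_rank1_upd)
  also have "\<dots> \<le> d * (exp (s + d) * exp_form f u)"
  proof (cases "d > 0")
    case True
    then show ?thesis
      using d by (intro mult_left_mono exp_form_rank1_upd_le[OF f _ u]) (auto simp: zero_le_mult_iff)
  next
    case False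
    show ?thesis
    proof (cases "d = 0")
      case False
      with \<open>\<not> d > 0\<close> have "d < 0" by simp
      with d have sd: "s + d \<le> 0" by (auto simp: zero_le_mult_iff)
      \<comment> \<open>For negative \<open>d\<close> a lower bound on the form at \<open>?g\<close>
        is wanted. It comes from the growth bound started at \<open>?g\<close> and run back to
        \<open>f\<close> over the nonnegative length \<open>- (s + d)\<close>.\<close>
      have "exp_form f u \<le> exp (- (s + d)) * exp_form ?g u"
        using exp_form_rank1_upd_le[OF g _ u, of "- (s + d)"] sd by (simp add: rank1_upd_rank1_upd)
      then have "exp (s + d) * exp_form f u \<le> exp (s + d) * (exp (- (s + d)) * exp_form ?g u)"
        by (intro mult_left_mono) auto
      also have "\<dots> = exp_form ?g u"
        unfolding mult.assoc[symmetric] exp_add[symmetric] by simp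
      finally have "exp (s + d) * exp_form f u \<le> exp_form ?g u" .
      then show ?thesis using \<open>d < 0\<close> by (intro mult_left_mono_neg) auto
    qed simp
  qed
  finally show ?thesis by (simp add: mult_ac)
qed

text \<open>A Golden--Thompson bound for rank one perturbations: with \<open>d = \<theta> / K\<close>, the increments of
  \<open>K\<close> steps add up to at most \<open>e\<^sup>d (e\<^sup>\<theta> - 1)\<close> times the form, and \<open>e\<^sup>d \<longlongrightarrow> 1\<close>.\<close>
lemma trace_exp_rank1_upd_le:
  assumes f: "selfadjoint f" and u: "norm u \<le> 1"
  shows "trace_exp (rank1_upd f \<theta> u) \<le> trace_exp f + (exp \<theta> - 1) * exp_form f u"
proof -
  have steps: "trace_exp (rank1_upd f (real j * d) u) \<le> trace_exp f + exp d * (exp (real j * d) - 1) * exp_form f u"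
    for j :: nat and d :: real
  proof (induction j)
    case (Suc j)
    have "0 \<le> real j * d * d" "0 \<le> (real j * d + d) * d"
      using mult_nonneg_nonneg[of "real j" "d * d"] mult_nonneg_nonneg[of "real j + 1" "d * d"]
      by (simp_all add: algebra_simps)
    then have "trace_exp (rank1_upd f (real j * d + d) u)
        \<le> trace_exp (rank1_upd f (real j * d) u) + d * exp (real j * d + d) * exp_form f u"
      using trace_exp_rank1_upd_step[OF f u, of "real j * d" d] by simp
    \<comment> \<open>Since (e^d - 1) e^((j+1)d) = e^d (e^((j+1)d) - e^(jd)), the bounds telescope.
      This avoids integrating over the path.\<close>
    also have "d * exp (real j * d + d) * exp_form f u
        \<le> (exp d - 1) * exp (real j * d + d) * exp_form f u"
    proof (intro mult_right_mono exp_form_nonneg)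
      show "d \<le> exp d - 1" using exp_ge_add_one_self[of d] by linarith
    qed auto
    finally show ?case
      using Suc.IH by (simp add: exp_add algebra_simps)
  qed simp
  have "(\<lambda>K. trace_exp f + exp (\<theta> / real (Suc K)) * (exp \<theta> - 1) * exp_form f u)
      \<longlonglongrightarrow> trace_exp f + exp 0 * (exp \<theta> - 1) * exp_form f u"
    by (intro tendsto_intros LIMSEQ_Suc[OF lim_const_over_n])
  then have "trace_exp (rank1_upd f \<theta> u) \<le> trace_exp f + exp 0 * (exp \<theta> - 1) * exp_form f u"
  proof (rule LIMSEQ_le_const, intro exI allI impI)
    fix K
    show "trace_exp (rank1_upd f \<theta> u) \<le> trace_exp f + exp (\<theta> / real (Suc K)) * (exp \<theta> - 1) * exp_form f u"
      using steps[of "Suc K" "\<theta> / real (Suc K)"] by simp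
  qed
  then show ?thesis by simp
qed

section \<open>Chernoff bound for isotropic rank one sums\<close>

text \<open>Jensen's inequality for the spectral weights \<open>(b \<bullet> x)\<^sup>2\<close>,
  which sum to one and are each at most one. It turns the existence of a bad direction
  \<open>x\<close> into an event about the trace alone.\<close>

lemma exp_quadratic_form_le_trace_exp:
  assumes f: "selfadjoint f" and x: "norm x = 1"
  shows "exp (x \<bullet> f x) \<le> trace_exp f"
proof -
  define B where "B = some_eigenbasis f"
  have B: "eigenbasis f B" unfolding B_def by (rule some_eigenbasis[OF f])
  have 1: "(\<Sum>b\<in>B. (b \<bullet> x)\<^sup>2) = 1" by (simp add: eigenbasis_norm[OF B] x)
  define r where "r = x \<bullet> f x"
  have r: "r = (\<Sum>b\<in>B. (b \<bullet> f b) * (b \<bullet> x)\<^sup>2)"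
    unfolding r_def by (rule eigenbasis_quadratic_form[OF B f])
  have "(\<Sum>b\<in>B. (b \<bullet> x)\<^sup>2 * (exp r * (1 + b \<bullet> f b - r)))
     = exp r * ((\<Sum>b\<in>B. (b \<bullet> x)\<^sup>2) * (1 - r) + (\<Sum>b\<in>B. (b \<bullet> f b) * (b \<bullet> x)\<^sup>2))"
    by (simp add: sum_distrib_left sum_distrib_right sum.distrib[symmetric] algebra_simps)
  then have "exp r = (\<Sum>b\<in>B. (b \<bullet> x)\<^sup>2 * (exp r * (1 + b \<bullet> f b - r)))"
    by (simp add: 1 r[symmetric])
  also have "\<dots> \<le> (\<Sum>b\<in>B. 1 * exp (b \<bullet> f b))"
  proof (rule sum_mono)
    fix b assume "b \<in> B"
    have "exp r * (1 + (b \<bullet> f b - r)) \<le> exp r * exp (b \<bullet> f b - r)"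
      by (intro mult_left_mono exp_ge_add_one_self) auto
    then have "exp r * (1 + b \<bullet> f b - r) \<le> exp (b \<bullet> f b)"
      by (simp add: exp_add[symmetric] algebra_simps)
    moreover have "(b \<bullet> x)\<^sup>2 \<le> 1"
      using member_le_sum[of b B "\<lambda>b. (b \<bullet> x)\<^sup>2"] \<open>b \<in> B\<close> B 1 by (simp add: eigenbasis_def)
    ultimately have "(b \<bullet> x)\<^sup>2 * (exp r * (1 + b \<bullet> f b - r)) \<le> (b \<bullet> x)\<^sup>2 * exp (b \<bullet> f b)"
      by (intro mult_left_mono) auto
    also have "\<dots> \<le> 1 * exp (b \<bullet> f b)"
      using \<open>(b \<bullet> x)\<^sup>2 \<le> 1\<close> by (intro mult_right_mono) auto
    finally show "(b \<bullet> x)\<^sup>2 * (exp r * (1 + b \<bullet> f b - r)) \<le> 1 * exp (b \<bullet> f b)" .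
  qed
  finally show ?thesis by (simp add: r_def trace_exp_def B_def)
qed

text \<open>This is U^T U for the matrix U with rows \<open>u s\<close>; the index set
  \<open>I\<close> is a parameter so that samples can be added one at a time.\<close>

definition gram_op :: "('s \<Rightarrow> 'a::euclidean_space) \<Rightarrow> 's set \<Rightarrow> 'a \<Rightarrow> 'a" where
  "gram_op u I = (\<lambda>x. \<Sum>s\<in>I. (u s \<bullet> x) *\<^sub>R u s)"

lemma selfadjoint_gram_op: "selfadjoint (\<lambda>x. r *\<^sub>R gram_op u I x)"
  unfolding selfadjoint_def gram_op_def
  by (auto intro!: linearI simp: inner_sum_left inner_sum_right inner_add_right inner_commute
      scaleR_left_distrib distrib_left sum.distrib scaleR_right_distrib scaleR_right.sum mult_ac)

lemma gram_op_quadratic_form: "x \<bullet> gram_op u I x = (\<Sum>s\<in>I. (u s \<bullet> x)\<^sup>2)"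
  by (simp add: gram_op_def inner_sum_right inner_commute power2_eq_square)

lemma trace_exp_zero: "trace_exp (\<lambda>x::'a::euclidean_space. 0) = DIM('a)"
  using eigenbasis_card[OF some_eigenbasis, of "\<lambda>x::'a. 0"]
  by (simp add: trace_exp_def selfadjoint_def module_hom_zero)

text \<open>Average over one sample with the others fixed. Since u u^T has mean c times the
  identity, the form in the rank one bound averages to c times the trace, so every sample
  contributes the scalar factor 1 + (e^\<theta> - 1) c.\<close>

lemma expectation_trace_exp_gram_le:
  fixes p :: "'m::finite pmf" and u :: "'m \<Rightarrow> 'a::euclidean_space" and I :: "'l::finite set"
  assumes u: "\<And>k. norm (u k) \<le> 1"
    and iso: "\<And>x. (\<Sum>k\<in>UNIV. pmf p k * (u k \<bullet> x)\<^sup>2) = c * (norm x)\<^sup>2"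
    and nonneg: "1 + (exp \<theta> - 1) * c \<ge> 0"
  shows "measure_pmf.expectation (Pi_pmf I undefined (\<lambda>_. p)) (\<lambda>\<omega>. trace_exp (\<lambda>x. \<theta> *\<^sub>R gram_op (u \<circ> \<omega>) I x))
     \<le> DIM('a) * (1 + (exp \<theta> - 1) * c) ^ card I"
  using finite[of I]
proof (induction I rule: finite_induct)
  case empty
  then show ?case by (simp add: gram_op_def trace_exp_zero)
next
  case (insert s I)
  let ?M = "Pi_pmf I undefined (\<lambda>_. p)"
  let ?T = "\<lambda>I \<omega>. trace_exp (\<lambda>x. \<theta> *\<^sub>R gram_op (u \<circ> \<omega>) I x)"
  have upd: "?T (insert s I) (fun_upd \<omega> s k) = trace_exp (rank1_upd (\<lambda>x. \<theta> *\<^sub>R gram_op (u \<circ> \<omega>) I x) \<theta> (u k))" for \<omega> k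
  proof -
    have "gram_op (u \<circ> fun_upd \<omega> s k) I = gram_op (u \<circ> \<omega>) I"
      using insert.hyps by (auto simp: gram_op_def intro!: sum.cong)
    then have "gram_op (u \<circ> fun_upd \<omega> s k) (insert s I) = (\<lambda>x. (u k \<bullet> x) *\<^sub>R u k + gram_op (u \<circ> \<omega>) I x)"
      using insert.hyps by (auto simp: gram_op_def fun_eq_iff)
    then show ?thesis by (simp add: rank1_upd_def algebra_simps)
  qed
  have step: "(\<Sum>k\<in>UNIV. pmf p k * ?T (insert s I) (fun_upd \<omega> s k)) \<le> (1 + (exp \<theta> - 1) * c) * ?T I \<omega>" for \<omega>
  proof -
    define f where "f = (\<lambda>x. \<theta> *\<^sub>R gram_op (u \<circ> \<omega>) I x)"
    have f: "selfadjoint f" unfolding f_def by (rule selfadjoint_gram_op)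
    define B where "B = some_eigenbasis f"
    have B: "eigenbasis f B" unfolding B_def by (rule some_eigenbasis[OF f])
    \<comment> \<open>Expand the form in the eigenbasis and apply isotropy to each basis
      vector.\<close>
    have "(\<Sum>k\<in>UNIV. pmf p k * exp_form f (u k)) = (\<Sum>k\<in>UNIV. \<Sum>b\<in>B. exp (b \<bullet> f b) * (pmf p k * (u k \<bullet> b)\<^sup>2))"
      by (simp add: exp_form_def B_def sum_distrib_left inner_commute mult_ac)
    also have "\<dots> = (\<Sum>b\<in>B. exp (b \<bullet> f b) * (c * (norm b)\<^sup>2))"
      unfolding iso[symmetric] sum_distrib_left by (rule sum.swap)
    also have "\<dots> = c * trace_exp f"
      using B by (simp add: trace_exp_def B_def[symmetric] eigenbasis_def sum_distrib_left mult_ac)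
    finally have ef: "(\<Sum>k\<in>UNIV. pmf p k * exp_form f (u k)) = c * trace_exp f" .
    have "(\<Sum>k\<in>UNIV. pmf p k * trace_exp (rank1_upd f \<theta> (u k)))
       \<le> (\<Sum>k\<in>UNIV. pmf p k * (trace_exp f + (exp \<theta> - 1) * exp_form f (u k)))"
      by (intro sum_mono mult_left_mono trace_exp_rank1_upd_le[OF f u]) auto
    also have "\<dots> = (\<Sum>k\<in>UNIV. pmf p k) * trace_exp f + (exp \<theta> - 1) * (\<Sum>k\<in>UNIV. pmf p k * exp_form f (u k))"
      by (simp add: sum_distrib_left sum_distrib_right sum.distrib[symmetric] algebra_simps)
    also have "(\<Sum>k\<in>UNIV. pmf p k) = 1" by (rule sum_pmf_eq_1) auto
    finally show ?thesis by (simp add: upd f_def[symmetric] ef algebra_simps)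
  qed
  have "measure_pmf.expectation (Pi_pmf (insert s I) undefined (\<lambda>_. p)) (?T (insert s I))
      = (\<Sum>k\<in>UNIV. pmf p k *\<^sub>R measure_pmf.expectation ?M (\<lambda>\<omega>. ?T (insert s I) (fun_upd \<omega> s k)))"
    using insert.hyps
    by (subst Pi_pmf_insert', simp, simp, subst pmf_expectation_bind[of UNIV]) (auto simp: map_pmf_def[symmetric])
  also have "\<dots> = measure_pmf.expectation ?M (\<lambda>\<omega>. \<Sum>k\<in>UNIV. pmf p k * ?T (insert s I) (fun_upd \<omega> s k))"
    by (subst Bochner_Integration.integral_sum) (auto intro!: integrable_measure_pmf_finite)
  also have "\<dots> \<le> measure_pmf.expectation ?M (\<lambda>\<omega>. (1 + (exp \<theta> - 1) * c) * ?T I \<omega>)"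
    by (intro integral_mono step integrable_measure_pmf_finite) auto
  also have "\<dots> = (1 + (exp \<theta> - 1) * c) * measure_pmf.expectation ?M (?T I)"
    by simp
  also have "\<dots> \<le> (1 + (exp \<theta> - 1) * c) * (DIM('a) * (1 + (exp \<theta> - 1) * c) ^ card I)"
    by (intro mult_left_mono insert.IH nonneg)
  finally show ?case using insert.hyps by (simp add: mult_ac o_def)
qed

text \<open>For \<open>d > 0\<close> the event is an upper tail; for \<open>d < 0\<close> the factor \<open>ln (1 + d)\<close> is negative
  and it is a lower tail.\<close>
lemma gram_chernoff:
  fixes p :: "'m::finite pmf" and u :: "'m \<Rightarrow> 'a::euclidean_space"
  assumes u: "\<And>k. norm (u k) \<le> 1"
    and iso: "\<And>x. (\<Sum>k\<in>UNIV. pmf p k * (u k \<bullet> x)\<^sup>2) = c * (norm x)\<^sup>2"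
    and c: "0 \<le> c" "c \<le> 1" and d: "d > -1"
  shows "measure_pmf.prob (Pi_pmf (UNIV :: 'l::finite set) undefined (\<lambda>_. p))
      {\<omega>. \<exists>x. norm x = 1 \<and> ln (1 + d) * ((1 + d) * (real CARD('l) * c)) \<le> ln (1 + d) * (\<Sum>s\<in>UNIV. (u (\<omega> s) \<bullet> x)\<^sup>2)}
     \<le> DIM('a) * (exp d / (1 + d) powr (1 + d)) powr (real CARD('l) * c)"
proof -
  \<comment> \<open>This value minimises (e^\<theta> - 1) L - \<theta> (1 + d) L, the exponent of
    the Chernoff bound.\<close>
  define \<theta> where "\<theta> = ln (1 + d)"
  define L where "L = real CARD('l) * c"
  have e\<theta>: "exp \<theta> = 1 + d" using d by (simp add: \<theta>_def)
  let ?M = "Pi_pmf (UNIV :: 'l::finite set) undefined (\<lambda>_. p)"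
  let ?T = "\<lambda>\<omega>. trace_exp (\<lambda>x. \<theta> *\<^sub>R gram_op (u \<circ> \<omega>) UNIV x)"
  have nonneg: "0 \<le> 1 + d * c"
  proof -
    have "-1 * c \<le> d * c" using d c by (intro mult_right_mono) auto
    then show ?thesis using c by linarith
  qed
  have T0: "?T \<omega> \<ge> 0" for \<omega> by (simp add: trace_exp_def sum_nonneg)
  have "measure_pmf.prob ?M {\<omega>. \<exists>x. norm x = 1 \<and> \<theta> * ((1 + d) * L) \<le> \<theta> * (\<Sum>s\<in>UNIV. (u (\<omega> s) \<bullet> x)\<^sup>2)}
    \<le> measure_pmf.prob ?M {\<omega> \<in> space ?M. exp (\<theta> * ((1 + d) * L)) \<le> ?T \<omega>}"
  proof (intro measure_pmf.finite_measure_mono subsetI)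
    fix \<omega> :: "'l \<Rightarrow> 'm"
    assume "\<omega> \<in> {\<omega>. \<exists>x. norm x = 1 \<and> \<theta> * ((1 + d) * L) \<le> \<theta> * (\<Sum>s\<in>UNIV. (u (\<omega> s) \<bullet> x)\<^sup>2)}"
    then obtain x where x: "norm x = 1" "\<theta> * ((1 + d) * L) \<le> \<theta> * (\<Sum>s\<in>UNIV. (u (\<omega> s) \<bullet> x)\<^sup>2)" by auto
    then have "exp (\<theta> * ((1 + d) * L)) \<le> exp (x \<bullet> (\<theta> *\<^sub>R gram_op (u \<circ> \<omega>) UNIV x))"
      by (simp add: gram_op_quadratic_form)
    also have "\<dots> \<le> ?T \<omega>"
      by (rule exp_quadratic_form_le_trace_exp[OF selfadjoint_gram_op x(1)])
    finally show "\<omega> \<in> {\<omega> \<in> space ?M. exp (\<theta> * ((1 + d) * L)) \<le> ?T \<omega>}" by simp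
  qed auto
  also have "\<dots> \<le> measure_pmf.expectation ?M ?T / exp (\<theta> * ((1 + d) * L))"
    by (rule integral_Markov_inequality_measure[where A = UNIV])
       (auto intro!: integrable_measure_pmf_finite simp: T0)
  also have "\<dots> \<le> DIM('a) * (1 + (exp \<theta> - 1) * c) ^ CARD('l) / exp (\<theta> * ((1 + d) * L))"
    by (intro divide_right_mono expectation_trace_exp_gram_le[OF u iso]) (use nonneg e\<theta> in auto)
  also have "\<dots> \<le> DIM('a) * exp (d * L) / exp (\<theta> * ((1 + d) * L))"
  proof (intro divide_right_mono mult_left_mono)
    have "(1 + d * c) ^ CARD('l) \<le> exp (d * c) ^ CARD('l)"
      using nonneg by (intro power_mono exp_ge_add_one_self) auto
    then show "(1 + (exp \<theta> - 1) * c) ^ CARD('l) \<le> exp (d * L)"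
      by (simp add: e\<theta> L_def exp_of_nat_mult[symmetric] mult_ac)
  qed auto
  also have "\<dots> = DIM('a) * (exp d / (1 + d) powr (1 + d)) powr L"
  proof -
    have "(1 + d) powr (1 + d) = exp (\<theta> * (1 + d))"
      using d by (simp add: powr_def \<theta>_def mult.commute)
    then have "exp d / (1 + d) powr (1 + d) = exp (d - \<theta> * (1 + d))" by (simp add: exp_diff)
    then show ?thesis by (simp add: powr_def exp_diff[symmetric] algebra_simps flip: times_divide_eq_right)
  qed
  finally show ?thesis by (simp add: \<theta>_def L_def)
qed

section \<open>QR factorisation and condition numbers\<close>

lemma inner_gram_matrix:
  fixes M :: "real^'n::finite^'m::finite"
  shows "x \<bullet> ((transpose M ** M) *v y) = (M *v x) \<bullet> (M *v y)"
  by (simp add: matrix_vector_mul_assoc[symmetric] transpose_matrix_vector inner_commute[of x]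
      dot_lmul_matrix inner_commute[of "M *v y"])

lemma norm_orthonormal_columns:
  fixes Q :: "real^'n::finite^'m::finite"
  assumes "transpose Q ** Q = mat 1"
  shows "norm (Q *v x) = norm x"
  using inner_gram_matrix[of x Q x] assms by (simp add: norm_eq_sqrt_inner)

text \<open>The other columns lie in the image of the hyperplane of vectors with zero coordinate
  \<open>i\<close>. By injectivity this image misses column \<open>i\<close>, the image of a vector
  outside the hyperplane.\<close>

lemma not_in_span_other_columns:
  fixes B :: "real^'n::finite^'m::finite"
  assumes inj: "inj ((*v) B)" and "i \<notin> J"
  shows "column i B \<notin> span ((\<lambda>j. column j B) ` J)"
proof
  assume "column i B \<in> span ((\<lambda>j. column j B) ` J)"
  moreover have "span ((\<lambda>j. column j B) ` J) \<subseteq> (*v) B ` {x. x $ i = 0}"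
  proof (rule span_minimal)
    show "(\<lambda>j. column j B) ` J \<subseteq> (*v) B ` {x. x $ i = 0}"
    proof clarify
      fix j assume "j \<in> J"
      then have "axis j 1 $ i = (0::real)" using assms(2) by (auto simp: axis_def)
      then show "column j B \<in> (*v) B ` {x. x $ i = 0}"
        by (intro image_eqI[of _ _ "axis j 1"]) (auto simp: matrix_vector_mult_basis)
    qed
    show "subspace ((*v) B ` {x. x $ i = 0})"
      by (intro linear_subspace_image) (auto simp: subspace_def)
  qed
  ultimately obtain x where x: "B *v x = column i B" "x $ i = 0" by auto
  then have "B *v x = B *v axis i 1" by (simp add: matrix_vector_mult_basis)
  then have "x = axis i 1" using inj by (simp add: inj_eq)
  with x show False by simp
qed

text \<open>Gram-Schmidt along the well-order of the index type: \<open>z i\<close> is the part of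
  column \<open>i\<close> orthogonal to all earlier columns, nonzero by the previous lemma.
  Existence gives the choice in \<open>qr_R\<close> its meaning.\<close>

lemma qr_exists:
  fixes B :: "real^('n::{finite,wellorder})^('l::finite)"
  assumes inj: "inj ((*v) B)"
  shows "\<exists>R. upper_tri R \<and> (\<forall>i. R $ i $ i > 0) \<and>
       (\<exists>Q::real^('n::{finite,wellorder})^('l::finite). transpose Q ** Q = mat 1 \<and> B = Q ** R)"
proof -
  define a where "a j = column j B" for j
  define S where "S i = span (a ` {..<i})" for i
  have "\<exists>z. a i - z \<in> S i \<and> (\<forall>w\<in>S i. z \<bullet> w = 0)" for i
  proof -
    obtain y z where "y \<in> S i" "\<And>w. w \<in> S i \<Longrightarrow> orthogonal z w" "a i = y + z"
      using orthogonal_subspace_decomp_exists[of "a ` {..<i}" "a i"] unfolding S_def by metis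
    then show ?thesis by (intro exI[of _ z]) (auto simp: orthogonal_def)
  qed
  then obtain z where z: "\<And>i. a i - z i \<in> S i" and z_orth: "\<And>i w. w \<in> S i \<Longrightarrow> z i \<bullet> w = 0"
    by metis
  have z0: "z i \<noteq> 0" for i
    using z[of i] not_in_span_other_columns[OF inj, of i "{..<i}"] by (auto simp: S_def a_def[abs_def])
  define q where "q i = z i /\<^sub>R norm (z i)" for i
  have S_mono: "S j \<subseteq> S i" if "j \<le> i" for i j
    unfolding S_def using that by (intro span_mono) auto
  have a_S: "a j \<in> S i" if "j < i" for i j
    unfolding S_def using that by (intro span_base) auto
  have z_S: "z j \<in> S i" if "j < i" for i j
  proof -
    have "a j - z j \<in> S i" using z[of j] S_mono[OF less_imp_le[OF that]] by blast
    then have "a j - (a j - z j) \<in> S i"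
      using a_S[OF that] unfolding S_def by (rule span_diff[rotated])
    then show ?thesis by simp
  qed
  have q_orth: "q i \<bullet> q j = 0" if "i \<noteq> j" for i j
  proof -
    have "z i \<bullet> z j = 0"
      using that z_orth[OF z_S, of i j] z_orth[OF z_S, of j i] by (cases "i < j") (auto simp: inner_commute)
    then show ?thesis by (simp add: q_def)
  qed
  have q_norm: "norm (q i) = 1" for i using z0 by (simp add: q_def)
  have inj_q: "inj q"
  proof (rule injI)
    fix i j assume "q i = q j"
    then have "q i \<bullet> q j = 1" using q_norm[of i] by (simp add: dot_square_norm)
    then show "i = j" using q_orth by force
  qed
  \<comment> \<open>Each column is \<open>z j\<close> plus a combination of earlier columns, so the
    normalised vectors span all columns and the orthonormal expansion yields the
    factorisation.\<close>
  have a_span: "a j \<in> span (range q)" for j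
  proof (induction j rule: less_induct)
    case (less j)
    have "S j \<subseteq> span (range q)"
      unfolding S_def using less by (intro span_minimal) auto
    moreover have "z j \<in> span (range q)"
    proof -
      have "norm (z j) *\<^sub>R q j \<in> span (range q)" by (intro span_scale span_base) auto
      then show ?thesis using z0 by (simp add: q_def)
    qed
    ultimately have "(a j - z j) + z j \<in> span (range q)" using z[of j] by (intro span_add) auto
    then show ?case by simp
  qed
  have expand: "(\<Sum>i\<in>UNIV. (q i \<bullet> a j) *\<^sub>R q i) = a j" for j
  proof -
    have "pairwise orthogonal (range q)"
      unfolding pairwise_def orthogonal_def using q_orth by (metis rangeE)
    then have "(\<Sum>v\<in>range q. (a j \<bullet> v) *\<^sub>R v) = a j"
      using a_span q_norm by (intro orthonormal_basis_expand) auto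
    then show ?thesis by (simp add: sum.reindex[OF inj_q] inner_commute)
  qed
  define R :: "real^('n::{finite,wellorder})^('n::{finite,wellorder})" where "R = (\<chi> i j. q i \<bullet> a j)"
  define Q :: "real^('n::{finite,wellorder})^'l" where "Q = (\<chi> s i. q i $ s)"
  have "upper_tri R"
    using z_orth[OF a_S] by (auto simp: upper_tri_def R_def q_def)
  moreover have "R $ i $ i > 0" for i
  proof -
    \<comment> \<open>The difference \<open>a i - z i\<close> lies in \<open>S i\<close> and is
      orthogonal to \<open>z i\<close>, so the diagonal entry of \<open>R\<close> is the norm of
      \<open>z i\<close>.\<close>
    have "z i \<bullet> (z i + (a i - z i)) = z i \<bullet> z i"
      using z_orth[OF z, of i] unfolding inner_add_right by simp
    then have "z i \<bullet> a i > 0" using z0[of i] by simp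
    then show ?thesis using z0[of i] by (simp add: R_def q_def)
  qed
  moreover have "transpose Q ** Q = mat 1"
  proof -
    have "(\<Sum>s\<in>UNIV. q i $ s * q j $ s) = (if i = j then 1 else 0)" for i j
      using q_orth[of i j] q_norm[of i] by (auto simp: inner_vec_def dot_square_norm[symmetric] norm_eq_1)
    then show ?thesis
      by (simp add: vec_eq_iff matrix_matrix_mult_def transpose_def Q_def mat_def)
  qed
  moreover have "B = Q ** R"
  proof -
    have "B $ s $ j = (\<Sum>i\<in>UNIV. q i $ s * (q i \<bullet> a j))" for s j
      using arg_cong[OF expand[of j], of "\<lambda>v. v $ s"] by (simp add: a_def column_def mult.commute)
    then show ?thesis by (simp add: vec_eq_iff matrix_matrix_mult_def Q_def R_def)
  qed
  ultimately show ?thesis by blast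
qed

lemma qr_R_factorization:
  fixes B :: "real^('n::{finite,wellorder})^('l::finite)"
  assumes "inj ((*v) B)"
  obtains Q :: "real^('n::{finite,wellorder})^('l::finite)"
  where "transpose Q ** Q = mat 1" "B = Q ** qr_R B"
  using someI_ex[OF qr_exists[OF assms]] that unfolding qr_R_def by blast

section \<open>Singular values and the condition number of the preconditioned matrix\<close>

lemma singular_values_finite_nonempty:
  fixes M :: "real^'n::finite^'m::finite"
  shows "finite (singular_values M)" "singular_values M \<noteq> {}"
proof -
  define f where "f = (*v) (transpose M ** M)"
  have f: "selfadjoint f"
    unfolding selfadjoint_def f_def
    using inner_gram_matrix[of _ M] by (auto simp: inner_commute)
  obtain B where B: "eigenbasis f B" using selfadjoint_eigenbasis[OF f] by blast
  have eig: "f b = (b \<bullet> f b) *\<^sub>R b" "b \<noteq> 0" if "b \<in> B" for b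
    using that B unfolding eigenbasis_def by force+
  have "B \<noteq> {}" using eigenbasis_card[OF B] by auto
  then obtain b where "b \<in> B" by auto
  then have "sqrt (b \<bullet> f b) \<in> singular_values M"
    using eig unfolding singular_values_def f_def by blast
  then show "singular_values M \<noteq> {}" by auto
  \<comment> \<open>Finiteness makes \<open>Max\<close> and \<open>Min\<close> in
    \<open>cond\<close> meaningful. Any eigenvector \<open>v\<close> meets some \<open>b\<close>
    nontrivially, and evaluating \<open>b \<bullet> f v\<close> in two ways identifies its
    eigenvalue with that of \<open>b\<close>.\<close>
  have "singular_values M \<subseteq> (\<lambda>b. sqrt (b \<bullet> f b)) ` B"
  proof
    fix \<sigma> assume "\<sigma> \<in> singular_values M"
    then obtain r v where r: "\<sigma> = sqrt r" and v: "v \<noteq> 0" "f v = r *\<^sub>R v"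
      unfolding singular_values_def f_def by blast
    have "\<exists>b\<in>B. b \<bullet> v \<noteq> 0"
    proof (rule ccontr)
      assume "\<not> ?thesis"
      then have "(norm v)\<^sup>2 = 0" using eigenbasis_norm[OF B, of v] by simp
      with v(1) show False by simp
    qed
    then obtain b where b: "b \<in> B" "b \<bullet> v \<noteq> 0" by blast
    have "r * (b \<bullet> v) = (b \<bullet> f b) * (b \<bullet> v)"
      using eigenbasis_inner[OF B f b(1), of v] v(2) by simp
    then show "\<sigma> \<in> (\<lambda>b. sqrt (b \<bullet> f b)) ` B" using b r by auto
  qed
  then show "finite (singular_values M)"
    using B by (auto simp: eigenbasis_def intro: finite_subset)
qed

text \<open>An eigenvector \<open>v\<close> of M^T M with eigenvalue r satisfies |M v|^2 = r |v|^2,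
  so the bounds place r strictly between 1/b and 1/a. Strictness lets the conclusion contradict the
  event of the theorem.\<close>

lemma cond_less:
  fixes M :: "real^'n::finite^'m::finite"
  assumes pos: "0 < a" "0 < b"
    and bounds: "\<And>v. v \<noteq> 0 \<Longrightarrow> a * (norm (M *v v))\<^sup>2 < (norm v)\<^sup>2"
      "\<And>v. v \<noteq> 0 \<Longrightarrow> (norm v)\<^sup>2 < b * (norm (M *v v))\<^sup>2"
  shows "cond M < sqrt (b / a)"
proof -
  have range: "sqrt (1 / b) < \<sigma> \<and> \<sigma> < sqrt (1 / a)" if "\<sigma> \<in> singular_values M" for \<sigma>
  proof -
    obtain r v where \<sigma>: "\<sigma> = sqrt r" and v: "v \<noteq> 0" "(transpose M ** M) *v v = r *\<^sub>R v"
      using \<open>\<sigma> \<in> singular_values M\<close> unfolding singular_values_def by blast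
    have Mv: "(norm (M *v v))\<^sup>2 = r * (norm v)\<^sup>2"
      using inner_gram_matrix[of v M v] v(2) by (simp add: power2_norm_eq_inner)
    have "a * r * (norm v)\<^sup>2 < 1 * (norm v)\<^sup>2" "1 * (norm v)\<^sup>2 < b * r * (norm v)\<^sup>2"
      using bounds[OF v(1)] by (simp_all add: Mv mult_ac)
    then have "a * r < 1" "1 < b * r"
      using v(1) by (simp_all only: mult_less_cancel_right) auto
    then show ?thesis using pos by (simp add: \<sigma> field_simps)
  qed
  have mem: "Max (singular_values M) \<in> singular_values M" "Min (singular_values M) \<in> singular_values M"
    using singular_values_finite_nonempty[of M] by auto
  have pos': "0 < sqrt (1 / b)" using pos by simp
  have "Max (singular_values M) / Min (singular_values M) < sqrt (1 / a) / sqrt (1 / b)"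
    using range[OF mem(1)] range[OF mem(2)] pos' by (intro frac_less) linarith+
  also have "sqrt (1 / a) / sqrt (1 / b) = sqrt (b / a)"
    by (simp add: real_sqrt_divide)
  finally show ?thesis by (simp add: cond_def)
qed

text \<open>Let S be the triangular factor of U R, with U R = P S, and put w = R S^(-1) v. Then X v
  = Q w has norm |w|, while U w = P v has norm |v|. Thus X inverts U up to isometries, and bounds on
  U transfer to X.\<close>

lemma sketch_cond_less:
  fixes A Q :: "real^('n::{finite,wellorder})^('m::finite)"
    and R :: "real^('n::{finite,wellorder})^('n::{finite,wellorder})"
    and U :: "real^('n::{finite,wellorder})^('l::finite)"
  assumes A: "rank A = CARD('n)" "A = Q ** R" and Q: "transpose Q ** Q = mat 1"
    and pos: "0 < a" "0 < b"
    and bounds: "\<And>x. norm x = 1 \<Longrightarrow> a < (norm (U *v x))\<^sup>2" "\<And>x. norm x = 1 \<Longrightarrow> (norm (U *v x))\<^sup>2 < b"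
  shows "rank (U ** R) = CARD('n)" "cond (A ** matrix_inv (qr_R (U ** R))) < sqrt (b / a)"
proof -
  have U: "a * (norm x)\<^sup>2 < (norm (U *v x))\<^sup>2" "(norm (U *v x))\<^sup>2 < b * (norm x)\<^sup>2" if "x \<noteq> 0" for x
  proof -
    let ?y = "x /\<^sub>R norm x"
    have "norm ?y = 1" using that by simp
    moreover have "(norm (U *v ?y))\<^sup>2 = (norm (U *v x))\<^sup>2 / (norm x)\<^sup>2"
      by (simp add: matrix_vector_mult_scaleR power_mult_distrib power_inverse divide_inverse mult.commute)
    ultimately have "a < (norm (U *v x))\<^sup>2 / (norm x)\<^sup>2" "(norm (U *v x))\<^sup>2 / (norm x)\<^sup>2 < b"
      using bounds[of ?y] by auto
    then show "a * (norm x)\<^sup>2 < (norm (U *v x))\<^sup>2" "(norm (U *v x))\<^sup>2 < b * (norm x)\<^sup>2"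
      using that by (simp_all add: pos_less_divide_eq pos_divide_less_eq)
  qed
  have "inj ((*v) A)" using A(1) full_rank_injective by blast
  then have R: "R *v x \<noteq> 0" if "x \<noteq> 0" for x
    using that by (metis A(2) injD matrix_vector_mul_assoc matrix_vector_mult_0_right)
  have "inj ((*v) (U ** R))"
  proof (rule injI)
    fix x y assume "(U ** R) *v x = (U ** R) *v y"
    then have "U *v (R *v (x - y)) = 0"
      by (simp add: matrix_vector_mul_assoc matrix_vector_mult_diff_distrib)
    then have "R *v (x - y) = 0"
      using U(1)[of "R *v (x - y)"] pos by (metis less_asym mult_pos_pos norm_zero zero_less_norm_iff zero_less_power zero_power2)
    then show "x = y" using R by (metis right_minus_eq)
  qed
  then show "rank (U ** R) = CARD('n)" using full_rank_injective by blast
  define S where "S = qr_R (U ** R)"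
  obtain P :: "real^('n::{finite,wellorder})^'l" where P: "transpose P ** P = mat 1" "U ** R = P ** S"
    unfolding S_def by (rule qr_R_factorization[OF \<open>inj ((*v) (U ** R))\<close>])
  have "inj ((*v) S)"
  proof (rule injI)
    fix x y assume "S *v x = S *v y"
    then have "(U ** R) *v x = (U ** R) *v y" unfolding P by (simp add: matrix_vector_mul_assoc[symmetric])
    then show "x = y" using \<open>inj ((*v) (U ** R))\<close> by (simp add: inj_eq)
  qed
  then have "invertible S"
    using matrix_left_invertible_injective invertible_left_inverse by blast
  then have "S ** matrix_inv S = mat 1"
    unfolding invertible_def matrix_inv_def by (rule someI2_ex) simp
  then have S: "S *v (matrix_inv S *v v) = v" for v
    by (simp add: matrix_vector_mul_assoc)
  have "cond (A ** matrix_inv S) < sqrt (b / a)"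
  proof (rule cond_less[OF pos])
    fix v :: "real^('n::{finite,wellorder})" assume "v \<noteq> 0"
    define w where "w = R *v (matrix_inv S *v v)"
    have "matrix_inv S *v v \<noteq> 0" using S[of v] \<open>v \<noteq> 0\<close> by auto
    then have "w \<noteq> 0" unfolding w_def by (rule R)
    have "(A ** matrix_inv S) *v v = Q *v w"
      by (simp add: w_def A(2) matrix_vector_mul_assoc matrix_mul_assoc)
    then have 1: "norm ((A ** matrix_inv S) *v v) = norm w"
      by (simp add: norm_orthonormal_columns[OF Q])
    have "U *v w = (U ** R) *v (matrix_inv S *v v)"
      by (simp add: w_def matrix_vector_mul_assoc matrix_mul_assoc)
    also have "\<dots> = P *v (S *v (matrix_inv S *v v))"
      unfolding P(2) by (simp only: matrix_vector_mul_assoc matrix_mul_assoc)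
    finally have "norm (U *v w) = norm v"
      by (simp only: S norm_orthonormal_columns[OF P(1)])
    then show "a * (norm ((A ** matrix_inv S) *v v))\<^sup>2 < (norm v)\<^sup>2"
      "(norm v)\<^sup>2 < b * (norm ((A ** matrix_inv S) *v v))\<^sup>2"
      using U[OF \<open>w \<noteq> 0\<close>] by (simp_all add: 1)
  qed
  then show "cond (A ** matrix_inv (qr_R (U ** R))) < sqrt (b / a)" by (simp add: S_def)
qed

section \<open>Leverage score sampling and the final bound\<close>

lemma sum_row_inner_square:
  fixes Q :: "real^'n::finite^'m::finite"
  shows "(\<Sum>k\<in>UNIV. (row k Q \<bullet> x)\<^sup>2) = (norm (Q *v x))\<^sup>2"
  unfolding power2_norm_eq_inner inner_vec_def[of "Q *v x"]
  by (simp add: matrix_vector_mul_component row_def power2_eq_square)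

text \<open>The weights sum to one because the squared Frobenius norm of Q, summed by columns
  instead of rows, is n. This is what \<open>embed_pmf\<close> requires.\<close>

lemma pmf_lev_pmf:
  fixes Q :: "real^'n::finite^'m::finite"
  assumes "transpose Q ** Q = mat 1"
  shows "pmf (lev_pmf Q) k = (norm (row k Q))\<^sup>2 / real CARD('n)"
proof -
  have "(\<Sum>k\<in>UNIV. (norm (row k Q))\<^sup>2) = (\<Sum>i\<in>UNIV. \<Sum>k\<in>UNIV. (row k Q \<bullet> axis i 1)\<^sup>2)"
    by (subst sum.swap) (simp add: power2_norm_eq_inner inner_axis, simp add: inner_vec_def power2_eq_square)
  also have "\<dots> = real CARD('n)"
    by (simp add: sum_row_inner_square norm_orthonormal_columns[OF assms])
  finally have "(\<Sum>k\<in>UNIV. (norm (row k Q))\<^sup>2 / real CARD('n)) = 1"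
    by (simp add: sum_divide_distrib[symmetric])
  then show ?thesis
    unfolding lev_pmf_def
    by (intro pmf_embed_pmf) (auto simp: nn_integral_count_space_finite sum_ennreal)
qed

theorem theorem3p4:
  fixes A Q :: "real^('n::{finite,wellorder})^('m::finite)"
    and R :: "real^('n::{finite,wellorder})^('n::{finite,wellorder})"
    and \<delta> \<epsilon> :: real
  assumes "rank A = CARD('n)"
    and "A = Q ** R" and "transpose Q ** Q = mat 1" and "upper_tri R"
    and "CARD('l::finite) \<ge> CARD('n)"
    and "\<delta> > 0" and "0 < \<epsilon>" and "\<epsilon> < 1"
  shows "measure_pmf.prob (Pi_pmf (UNIV :: 'l set) undefined (\<lambda>_. lev_pmf Q))
      {\<omega>. if rank (sampled_matrix A Q \<omega>) = CARD('n)
           then cond (A ** matrix_inv (qr_R (sampled_matrix A Q \<omega>)))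
                  \<ge> sqrt ((1 + \<delta>) / (1 - \<epsilon>))
           else True}
    \<le> real CARD('n) *
       ((exp (- \<epsilon>) / (1 - \<epsilon>) powr (1 - \<epsilon>)) powr (real CARD('l) / real CARD('n))
      + (exp \<delta> / (1 + \<delta>) powr (1 + \<delta>)) powr (real CARD('l) / real CARD('n)))"
    (is "measure_pmf.prob ?M ?E \<le> _")
proof -
  let ?L = "real CARD('l) / real CARD('n)"
  \<comment> \<open>A zero row gives \<open>u k = 0\<close>, as division by zero yields 0; hence
    only \<open>norm (u k) \<le> 1\<close>. Such an index has probability zero.\<close>
  define u where "u k = (1 / norm (row k Q)) *\<^sub>R row k Q" for k
  define U :: "('l \<Rightarrow> 'm) \<Rightarrow> real^('n::{finite,wellorder})^'l" where "U \<omega> = (\<chi> s. u (\<omega> s))" for \<omega>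
  define T where "T d = {\<omega> :: 'l \<Rightarrow> 'm. \<exists>x. norm x = 1 \<and>
      ln (1 + d) * ((1 + d) * (real CARD('l) * (1 / real CARD('n)))) \<le> ln (1 + d) * (\<Sum>s\<in>UNIV. (u (\<omega> s) \<bullet> x)\<^sup>2)}" for d
  have Unorm: "(norm (U \<omega> *v x))\<^sup>2 = (\<Sum>s\<in>UNIV. (u (\<omega> s) \<bullet> x)\<^sup>2)" for \<omega> x
    unfolding sum_row_inner_square[symmetric] by (simp add: U_def row_def vec_nth_inverse)
  have u: "norm (u k) \<le> 1" for k by (simp add: u_def)
  have iso: "(\<Sum>k\<in>UNIV. pmf (lev_pmf Q) k * (u k \<bullet> x)\<^sup>2) = (1 / real CARD('n)) * (norm x)\<^sup>2" for x
  proof -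
    \<comment> \<open>The sampling weight cancels the normalisation exactly, leaving the rows of Q,
      whose columns are orthonormal.\<close>
    have "pmf (lev_pmf Q) k * (u k \<bullet> x)\<^sup>2 = (1 / real CARD('n)) * (row k Q \<bullet> x)\<^sup>2" for k
      by (cases "row k Q = 0") (simp_all add: pmf_lev_pmf[OF assms(3)] u_def power_divide)
    then have "(\<Sum>k\<in>UNIV. pmf (lev_pmf Q) k * (u k \<bullet> x)\<^sup>2) = (1 / real CARD('n)) * (norm (Q *v x))\<^sup>2"
      by (simp only: sum_distrib_left[symmetric] sum_row_inner_square)
    then show ?thesis by (simp add: norm_orthonormal_columns[OF assms(3)])
  qed
  have tail: "measure_pmf.prob ?M (T d) \<le> real CARD('n) * (exp d / (1 + d) powr (1 + d)) powr ?L" if "d > -1" for d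
    using gram_chernoff[where 'l='l, OF u iso _ _ that] by (simp add: T_def)
  \<comment> \<open>Row selection and row scaling commute with right multiplication by
    \<open>R\<close>.\<close>
  have sampled: "sampled_matrix A Q \<omega> = U \<omega> ** R" for \<omega>
    by (simp add: sampled_matrix_def U_def u_def assms(2) vec_eq_iff matrix_matrix_mult_def row_def
        sum_distrib_left mult.assoc)
  have "?E \<subseteq> T (-\<epsilon>) \<union> T \<delta>"
  proof (rule ccontr)
    assume "\<not> ?E \<subseteq> T (-\<epsilon>) \<union> T \<delta>"
    then obtain \<omega> where \<omega>: "\<omega> \<in> ?E" "\<omega> \<notin> T (-\<epsilon>)" "\<omega> \<notin> T \<delta>" by blast
    have lo: "(1 - \<epsilon>) * ?L < (norm (U \<omega> *v x))\<^sup>2" and hi: "(norm (U \<omega> *v x))\<^sup>2 < (1 + \<delta>) * ?L" if "norm x = 1" for x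
    proof -
      \<comment> \<open>Outside both tails every unit vector obeys two strict bounds; the negative
        factor ln (1 - \<epsilon>) reverses the first into a lower bound.\<close>
      have "ln (1 - \<epsilon>) * (norm (U \<omega> *v x))\<^sup>2 < ln (1 - \<epsilon>) * ((1 - \<epsilon>) * ?L)"
        "ln (1 + \<delta>) * (norm (U \<omega> *v x))\<^sup>2 < ln (1 + \<delta>) * ((1 + \<delta>) * ?L)"
        using \<omega>(2,3) that by (auto simp: T_def Unorm not_le)
      moreover have "ln (1 - \<epsilon>) < 0" "ln (1 + \<delta>) > 0" using assms by auto
      ultimately show "(1 - \<epsilon>) * ?L < (norm (U \<omega> *v x))\<^sup>2" "(norm (U \<omega> *v x))\<^sup>2 < (1 + \<delta>) * ?L"
        by (simp_all only: mult_less_cancel_left_pos mult_less_cancel_left_neg)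
    qed
    have "?L > 0" by simp
    have pos: "(1 - \<epsilon>) * ?L > 0" "(1 + \<delta>) * ?L > 0" using assms \<open>?L > 0\<close> by (auto intro!: mult_pos_pos)
    \<comment> \<open>The common factor l/n cancels, which gives the stated threshold.\<close>
    have "((1 + \<delta>) * ?L) / ((1 - \<epsilon>) * ?L) = (1 + \<delta>) / (1 - \<epsilon>)" using \<open>?L > 0\<close> by simp
    then have "rank (sampled_matrix A Q \<omega>) = CARD('n)"
      "cond (A ** matrix_inv (qr_R (sampled_matrix A Q \<omega>))) < sqrt ((1 + \<delta>) / (1 - \<epsilon>))"
      using sketch_cond_less[OF assms(1-3) pos lo hi] by (simp_all only: sampled)
    with \<omega>(1) show False by simp
  qed
  then have "measure_pmf.prob ?M ?E \<le> measure_pmf.prob ?M (T (-\<epsilon>) \<union> T \<delta>)"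
    by (intro measure_pmf.finite_measure_mono) auto
  also have "\<dots> \<le> measure_pmf.prob ?M (T (-\<epsilon>)) + measure_pmf.prob ?M (T \<delta>)"
    by (intro measure_Un_le) auto
  also have "\<dots> \<le> real CARD('n) * (exp (-\<epsilon>) / (1 + -\<epsilon>) powr (1 + -\<epsilon>)) powr ?L
      + real CARD('n) * (exp \<delta> / (1 + \<delta>) powr (1 + \<delta>)) powr ?L"
    using assms by (intro add_mono tail) auto
  finally show ?thesis by (simp add: distrib_left)
qed

end
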